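(* Let $A$ be a finite alphabet. For every sentence $I$ over $A$, the coloured ribbon non-commutative Schur function $R_I$ in $\mathrm{NSym}_A$ satisfies $$(S\circ r)(R_I)=(-1)^{|I|}R_{I^c}.$$
   Context: $\Bbbk$ is a field of characteristic zero. A sentence $I=(w_1,\dots,w_m)$ over $A$ is a finite sequence of non-empty words in letters of $A$; $1$ is the empty sentence. $|I|$ is the total number of letters; the maximal word of $I$ is $w(I)=w_1\cdots w_m$. $I\cdot J$ is concatenation of sequences of words. Write $J\preccurlyeq I$ ($J$ refines $I$) if the words of $I$ can be obtained by concatenating adjacent words of $J$. The reversal is $I^r=(w_m,\dots,w_1)$. The complement $I^c$ is the sentence with the same maximal word as $I$ in which two consecutive letters of $w(I)$ are separated (belong to different words) if and only if they are not separated in $I$; e.g. $(aba,ca,bac)^c=(a,b,ac,ab,a,c)$. $\mathrm{NSym}_A$ is the Hopf algebra over $\Bbbk$ with linear basis $(H_I)$ indexed by sentences, graded by $|I|$, with product $H_IH_J=H_{I\cdot J}$ and coproduct $\Delta(H_I)=\sum_{J\subset I}H_{\widetilde{I\setminus J}}\otimes H_{\widetilde J}$. Here, for $I=(w_1,\dots,w_m)$, $J=(v_1,\dots,v_m)$ runs over sequences of possibly empty words such that $w_i=u_iv_i$ for some words $u_i$; $I\setminus J=(u_1,\dots,u_m)$; and tilde means deleting the empty words. $S$ is its antipode, and $r$ is the linear map with $r(H_I)=H_{I^r}$. $\mathrm{QSym}_A$ is the graded dual of $\mathrm{NSym}_A$ with basis $(M_I)$ dual to $(H_I)$: $\langle M_I,H_J\rangle=\delta_{I,J}$.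 The fundamental functions $F_I=\sum_{J\preccurlyeq I}M_J$ form a basis of $\mathrm{QSym}_A$, and $(R_I)$ is the basis of $\mathrm{NSym}_A$ dual to it: $\langle F_I,R_J\rangle=\delta_{I,J}$. *)

theory Defs
  imports Complex_Main "HOL-Library.Poly_Mapping" "HOL-Library.Sublist"
begin

section \<open>Sentences\<close>

typedef 'a sentence = "{ws :: 'a list list. [] \<notin> set ws}"
  morphisms words_of Sentence
  by (rule exI[of _ "[]"]) simp

setup_lifting type_definition_sentence

text \<open>Sentences form the free monoid on the non-empty words. It is written additively
  (\<open>I + J\<close> is the concatenation of sequences of words, \<open>0\<close> is the empty sentence), because
  the product on \<open>poly_mapping\<close> is convolution over an additively written index monoid.\<close>

instantiation sentence :: (type) monoid_add
begin

lift_definition zero_sentence :: "'a sentence" is "[]" by simp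

lift_definition plus_sentence :: "'a sentence \<Rightarrow> 'a sentence \<Rightarrow> 'a sentence" is "(@)" by simp

instance by standard (transfer, simp)+

end

definition max_word :: "'a sentence \<Rightarrow> 'a list" where
  "max_word I = concat (words_of I)"

definition letters :: "'a sentence \<Rightarrow> nat" where
  "letters I = length (max_word I)"

text \<open>\<open>refines J I\<close> is $J \preccurlyeq I$: the words of \<open>J\<close> are cut into groups of adjacent words,
  and concatenating each group gives the words of \<open>I\<close>. The groups are automatically non-empty,
  since \<open>I\<close> has no empty word.\<close>

definition refines :: "'a sentence \<Rightarrow> 'a sentence \<Rightarrow> bool" where
  "refines J I \<longleftrightarrow> (\<exists>groups. concat groups = words_of J \<and> map concat groups = words_of I)"

lift_definition reversal :: "'a sentence \<Rightarrow> 'a sentence" is rev by simp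

text \<open>\<open>separated I k\<close>: a word of \<open>I\<close> ends exactly after the first \<open>k\<close> letters of the maximal word.
  For \<open>0 < k < letters I\<close> this says that the \<open>k\<close>-th and \<open>(k+1)\<close>-st letters (counting from one)
  belong to different words of \<open>I\<close>.\<close>

definition separated :: "'a sentence \<Rightarrow> nat \<Rightarrow> bool" where
  "separated I k \<longleftrightarrow> (\<exists>us vs. words_of I = us @ vs \<and> length (concat us) = k)"

definition complement :: "'a sentence \<Rightarrow> 'a sentence" where
  "complement I = (THE J. max_word J = max_word I \<and>
     (\<forall>k. 0 < k \<and> k < letters I \<longrightarrow> (separated J k \<longleftrightarrow> \<not> separated I k)))"


section \<open>The Hopf algebra of coloured non-commutative symmetric functions\<close>

text \<open>The free vector space on the sentences. The ring structure of \<open>poly_mapping\<close> is the product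
  $H_I H_J = H_{I \cdot J}$, see \<open>H_mult\<close> below.\<close>

type_synonym ('a, 'k) nsym = "'a sentence \<Rightarrow>\<^sub>0 'k"

text \<open>The tensor square, where the basis element indexed by \<open>(I, J)\<close> is $H_I \otimes H_J$.\<close>

type_synonym ('a, 'k) nsym2 = "('a sentence \<times> 'a sentence) \<Rightarrow>\<^sub>0 'k"

definition scale :: "'k::field \<Rightarrow> ('b \<Rightarrow>\<^sub>0 'k) \<Rightarrow> ('b \<Rightarrow>\<^sub>0 'k)" where
  "scale c = Poly_Mapping.map ((*) c)"

lemma lookup_scale: "Poly_Mapping.lookup (scale c p) i = c * Poly_Mapping.lookup p i"
  unfolding scale_def by transfer (simp add: when_def)

interpretation poly_mapping_vs: vector_space scale
  by standard (rule poly_mapping_eqI, simp add: lookup_scale lookup_add algebra_simps)+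

text \<open>The linear map sending the basis element indexed by \<open>i\<close> to \<open>f i\<close>.\<close>

definition lin_ext :: "('b \<Rightarrow> ('c \<Rightarrow>\<^sub>0 'k)) \<Rightarrow> ('b \<Rightarrow>\<^sub>0 'k::field) \<Rightarrow> ('c \<Rightarrow>\<^sub>0 'k)" where
  "lin_ext f x = (\<Sum>i\<in>Poly_Mapping.keys x. scale (Poly_Mapping.lookup x i) (f i))"

definition H :: "'a sentence \<Rightarrow> ('a, 'k::field) nsym" where
  "H I = Poly_Mapping.single I 1"

lemma H_mult: "H I * H J = H (I + J)"
  by (simp add: H_def mult_single)

lemma lin_ext_H: "lin_ext f (H I) = f I"
  by (simp add: lin_ext_def H_def)

definition subsentences :: "'a sentence \<Rightarrow> 'a list list set" where
  "subsentences I = {vs. list_all2 suffix vs (words_of I)}"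

text \<open>\<open>removed I vs\<close> is the sequence $I \setminus J$, that is, $(u_1, \dots, u_m)$ with $w_i = u_i v_i$.\<close>

definition removed :: "'a sentence \<Rightarrow> 'a list list \<Rightarrow> 'a list list" where
  "removed I vs = map2 (\<lambda>w v. take (length w - length v) w) (words_of I) vs"

lift_definition tilde :: "'a list list \<Rightarrow> 'a sentence" is "filter (\<lambda>w. w \<noteq> [])" by simp

definition coproduct :: "('a, 'k::field) nsym \<Rightarrow> ('a, 'k) nsym2" where
  "coproduct = lin_ext (\<lambda>I. \<Sum>J\<in>subsentences I. Poly_Mapping.single (tilde (removed I J), tilde J) 1)"

text \<open>The composition of the unit with the counit, the counit being the projection to the degree
  zero component, which is spanned by $H_1 = 1$.\<close>

definition unit_counit :: "('a, 'k::field) nsym \<Rightarrow> ('a, 'k) nsym" where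
  "unit_counit x = scale (Poly_Mapping.lookup x 0) 1"

text \<open>$m \circ (f \otimes g) \circ \Delta$ for linear \<open>f\<close> and \<open>g\<close>.\<close>

definition convolution ::
  "(('a, 'k::field) nsym \<Rightarrow> ('a, 'k) nsym) \<Rightarrow> (('a, 'k) nsym \<Rightarrow> ('a, 'k) nsym)
    \<Rightarrow> ('a, 'k) nsym \<Rightarrow> ('a, 'k) nsym" where
  "convolution f g x = lin_ext (\<lambda>(I, J). f (H I) * g (H J)) (coproduct x)"

text \<open>A two-sided convolution inverse of the identity, hence unique.\<close>

definition is_antipode :: "(('a, 'k::field) nsym \<Rightarrow> ('a, 'k) nsym) \<Rightarrow> bool" where
  "is_antipode S \<longleftrightarrow> Vector_Spaces.linear scale scale S \<and>
     convolution S id = unit_counit \<and> convolution id S = unit_counit"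

definition antipode :: "('a, 'k::field) nsym \<Rightarrow> ('a, 'k) nsym" where
  "antipode = (THE S. is_antipode S)"

definition reversal_map :: "('a, 'k::field) nsym \<Rightarrow> ('a, 'k) nsym" where
  "reversal_map = lin_ext (\<lambda>I. H (reversal I))"


section \<open>The graded dual, fundamental functions and ribbons\<close>

text \<open>The graded dual consists of the linear functionals that vanish on all but finitely many
  homogeneous components. The pairing of \<open>f\<close> with \<open>x\<close> is \<open>f x\<close>.\<close>

definition QSym :: "(('a::finite, 'k::field) nsym \<Rightarrow> 'k) set" where
  "QSym = {f. Vector_Spaces.linear scale (*) f \<and> (\<exists>N. \<forall>I. letters I \<ge> N \<longrightarrow> f (H I) = 0)}"

definition M :: "'a sentence \<Rightarrow> ('a, 'k::field) nsym \<Rightarrow> 'k" where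
  "M I x = Poly_Mapping.lookup x I"

definition F :: "'a sentence \<Rightarrow> ('a, 'k::field) nsym \<Rightarrow> 'k" where
  "F I x = (\<Sum>J | refines J I. M J x)"

text \<open>The family dual to \<open>F\<close>; it is unique because the \<open>F I\<close> separate points.\<close>

definition R :: "'a sentence \<Rightarrow> ('a, 'k::field) nsym" where
  "R = (THE r. \<forall>I J. F I (r J) = (if I = J then 1 else 0))"

lemma M_H: "M I (H J) = (if I = J then 1 else 0)"
  by (auto simp: M_def H_def lookup_single)

text \<open>The index sets of the sums above are finite.\<close>

lemma max_word_refines: "refines J I \<Longrightarrow> max_word J = max_word I"
proof -
  have "concat (concat gs) = concat (map concat gs)" for gs :: "'a list list list"
    by (induction gs) auto
  then show "refines J I \<Longrightarrow> max_word J = max_word I"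
    unfolding refines_def max_word_def by metis
qed

lemma finite_refinements: "finite {J. refines J I}"
proof -
  let ?n = "letters I"
  let ?W = "{w. set w \<subseteq> set (max_word I) \<and> length w \<le> ?n}"
  have bound: "length ws \<le> length (concat ws)" if "[] \<notin> set ws" for ws :: "'a list list"
    using that
  proof (induction ws)
    case (Cons w ws)
    then have "length w \<ge> 1"
      by (cases w) auto
    with Cons show ?case
      by simp
  qed simp
  have member: "length w \<le> length (concat ws)" if "w \<in> set ws" for w and ws :: "'a list list"
    using that by (induction ws) auto
  have "words_of J \<in> {ws. set ws \<subseteq> ?W \<and> length ws \<le> ?n}" if "refines J I" for J
  proof -
    have eq: "concat (words_of J) = max_word I"
      using max_word_refines[OF that] by (simp add: max_word_def)
    have "[] \<notin> set (words_of J)"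
      using words_of[of J] by simp
    from bound[OF this] have "length (words_of J) \<le> ?n"
      by (simp add: eq letters_def)
    moreover have "w \<in> ?W" if "w \<in> set (words_of J)" for w
    proof -
      have "set w \<subseteq> set (concat (words_of J))"
        using that by auto
      then show ?thesis
        using member[OF that] by (simp only: eq letters_def mem_Collect_eq)
    qed
    ultimately show ?thesis
      by blast
  qed
  then have "words_of ` {J. refines J I} \<subseteq> {ws. set ws \<subseteq> ?W \<and> length ws \<le> ?n}"
    by blast
  moreover have "finite {ws. set ws \<subseteq> ?W \<and> length ws \<le> ?n}"
    by (intro finite_lists_length_le) simp_all
  ultimately have "finite (words_of ` {J. refines J I})"
    by (rule finite_subset)
  moreover have "inj_on words_of {J. refines J I}"
    by (rule inj_onI) (simp add: words_of_inject)
  ultimately show ?thesis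
    by (rule finite_imageD)
qed

lemma finite_subsentences: "finite (subsentences I)"
proof -
  let ?V = "\<Union>w\<in>set (words_of I). set (suffixes w)"
  have "subsentences I \<subseteq> {vs. set vs \<subseteq> ?V \<and> length vs = length (words_of I)}"
  proof
    fix vs assume "vs \<in> subsentences I"
    then have "list_all2 suffix vs (words_of I)"
      by (simp add: subsentences_def)
    then have "\<exists>w\<in>set (words_of I). suffix v w" if "v \<in> set vs" for v
      using that \<open>list_all2 suffix vs (words_of I)\<close>
      by (metis in_set_conv_nth list_all2_conv_all_nth)
    with \<open>list_all2 suffix vs (words_of I)\<close>
    show "vs \<in> {vs. set vs \<subseteq> ?V \<and> length vs = length (words_of I)}"
      by (auto dest: list_all2_lengthD)
  qed
  then show ?thesis
    by (rule finite_subset) (simp add: finite_lists_length_eq)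
qed

lemma functional_linearI:
  fixes f :: "('b \<Rightarrow>\<^sub>0 'k::field) \<Rightarrow> 'k"
  assumes "\<And>x y. f (x + y) = f x + f y" and "\<And>c x. f (scale c x) = c * f x"
  shows "Vector_Spaces.linear scale (*) f"
proof -
  have "vector_space ((*) :: 'k \<Rightarrow> 'k \<Rightarrow> 'k)"
    by standard (simp_all add: algebra_simps)
  then show ?thesis
    using assms poly_mapping_vs.vector_space_axioms by (simp add: Vector_Spaces.linear_iff)
qed

lemma M_in_QSym: "M I \<in> QSym"
proof -
  have "Vector_Spaces.linear scale (*) (M I)"
    by (rule functional_linearI) (simp_all add: M_def lookup_add lookup_scale)
  moreover have "\<forall>J. letters J \<ge> Suc (letters I) \<longrightarrow> M I (H J) = 0"
    by (auto simp: M_H)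
  ultimately show ?thesis
    by (auto simp: QSym_def)
qed

lemma F_in_QSym: "F I \<in> QSym"
proof -
  have "Vector_Spaces.linear scale (*) (F I)"
    by (rule functional_linearI)
      (simp_all add: F_def M_def lookup_add lookup_scale sum.distrib sum_distrib_left)
  moreover have "\<forall>J. letters J \<ge> Suc (letters I) \<longrightarrow> F I (H J) = 0"
    by (fastforce simp: F_def M_H letters_def dest: max_word_refines intro!: sum.neutral)
  ultimately show ?thesis
    by (auto simp: QSym_def)
qed

end

theory Submission
  imports Defs
begin

text \<open>A sentence with $n$ letters amounts to its maximal word together with its set of cuts in
  $\{0, \dots, n\}$, and refinement is inclusion of cuts. Since $S$ is an antihomomorphism,
  $S(r(H_J)) = \sum_{L \preccurlyeq J} (-1)^{\ell(L)} H_L$, where $\ell$ is the number of words, so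
  $\langle F_K, S(r(H_J)) \rangle$ is an alternating sum over the common refinements of \<open>J\<close> and
  \<open>K\<close>. It vanishes unless the cuts of \<open>J\<close> and \<open>K\<close> together are all of
  $\{0, \dots, n\}$, that is $J \preccurlyeq K^c$. Hence $S \circ r$ is adjoint to
  $F_K \mapsto (-1)^{|K|} F_{K^c}$, and pairing with the dual basis gives the claim.\<close>


section \<open>Sentences as sets of cuts\<close>

text \<open>Both trivial cuts, 0 and the total length, are included. This keeps the recursion on
  \<open>w # ws\<close> uniform and makes a sentence have exactly one more cut than it has
  words.\<close>

definition cuts :: "'a list list \<Rightarrow> nat set" where
  "cuts ws = {length (concat us) | us. prefix us ws}"

lemma cuts_Nil [simp]: "cuts [] = {0}"
  by (auto simp: cuts_def)

lemma cuts_Cons [simp]: "cuts (w # ws) = insert 0 ((+) (length w) ` cuts ws)"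
proof -
  have "{us. prefix us (w # ws)} = insert [] ((#) w ` {us. prefix us ws})"
    by (auto simp: prefix_Cons)
  then show ?thesis
    unfolding cuts_def setcompr_eq_image by (simp add: image_image)
qed

lemma zero_in_cuts [simp]: "0 \<in> cuts ws"
  by (cases ws) auto

lemma length_in_cuts: "length (concat ws) \<in> cuts ws"
  unfolding cuts_def by blast

lemma cuts_le: "k \<in> cuts ws \<Longrightarrow> k \<le> length (concat ws)"
  by (auto simp: cuts_def prefix_def)

lemma separated_iff_cuts: "separated I k \<longleftrightarrow> k \<in> cuts (words_of I)"
  by (auto simp: separated_def cuts_def prefix_def)

text \<open>Without empty words the partial lengths increase strictly, so different prefixes give
  different cuts; the empty prefix accounts for the extra one.\<close>

lemma card_cuts: "[] \<notin> set ws \<Longrightarrow> card (cuts ws) = Suc (length ws)"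
proof (induction ws)
  case (Cons w ws)
  have "finite (cuts ws)"
    using cuts_le by (metis finite_nat_set_iff_bounded_le)
  moreover have "0 \<notin> (+) (length w) ` cuts ws"
    using Cons.prems by auto
  ultimately show ?case
    using Cons by (simp add: card_image)
qed simp

section \<open>Refinement as inclusion of cuts\<close>

lemma cuts_mono_groups: "cuts (map concat groups) \<subseteq> cuts (concat groups)"
proof
  fix k assume "k \<in> cuts (map concat groups)"
  then obtain us where "prefix us (map concat groups)" and k: "k = length (concat us)"
    by (auto simp: cuts_def)
  \<comment> \<open>A prefix of the coarse list comes from whole groups; flattening these gives a
    prefix of the fine list with the same number of letters.\<close>
  then obtain gs where us: "us = map concat gs" and "prefix gs groups"
    by (metis prefixE prefixI append_eq_map_conv)
  then have "prefix (concat gs) (concat groups)"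
    by (auto simp: prefix_def)
  moreover have "length (concat us) = length (concat (concat gs))"
    unfolding us by (induction gs) auto
  ultimately show "k \<in> cuts (concat groups)"
    unfolding cuts_def k by blast
qed

text \<open>The end of the first coarse word is also a cut of the fine list. The fine words before
  it form the first group, and the rest is grouped recursively once the inclusion of cuts is
  transferred to it.\<close>

lemma groups_if_cuts_subset:
  assumes "concat vs = concat ws" and "cuts ws \<subseteq> cuts vs" and "[] \<notin> set ws" "[] \<notin> set vs"
  shows "\<exists>groups. concat groups = vs \<and> map concat groups = ws"
  using assms
proof (induction ws arbitrary: vs)
  case Nil
  then have "vs = []"
    by (cases vs) auto
  then show ?case
    by simp
next
  case (Cons w ws)
  have "length w \<in> cuts vs"
    using Cons.prems(2) by force
  then obtain us ts where vs: "vs = us @ ts" and len: "length (concat us) = length w"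
    by (auto simp: cuts_def prefix_def)
  with Cons.prems(1) have w: "concat us = w" and ts: "concat ts = concat ws"
    by auto
  have "cuts ws \<subseteq> cuts ts"
  proof
    fix k assume "k \<in> cuts ws"
    then have "length w + k \<in> cuts vs"
      using Cons.prems(2) by auto
    then obtain us' where us': "prefix us' vs" "length (concat us') = length w + k"
      by (auto simp: cuts_def)
    \<comment> \<open>The prefix \<open>us'\<close> has at least as many letters as
      \<open>us\<close>. It can lie inside \<open>us\<close> only for \<open>k = 0\<close>; in the
      other case it extends \<open>us\<close> by a prefix of \<open>ts\<close> with \<open>k\<close>
      letters.\<close>
    have "prefix us' us \<or> (\<exists>xs. us' = us @ xs \<and> prefix xs ts)"
      using us'(1) unfolding vs prefix_append by blast
    then show "k \<in> cuts ts"
    proof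
      assume "prefix us' us"
      then have "k = 0"
        using us'(2) len by (auto simp: prefix_def)
      then show ?thesis
        by simp
    next
      assume "\<exists>xs. us' = us @ xs \<and> prefix xs ts"
      then show ?thesis
        using us'(2) len by (force simp: cuts_def)
    qed
  qed
  then obtain groups where "concat groups = ts" "map concat groups = ws"
    using Cons.IH[OF ts] Cons.prems vs by auto
  then have "concat (us # groups) = vs \<and> map concat (us # groups) = w # ws"
    using vs w by simp
  then show ?case
    by (rule exI)
qed

lemma words_of_nonempty [simp]: "[] \<notin> set (words_of I)"
  using words_of[of I] by simp

lemma refines_iff_cuts:
  "refines J I \<longleftrightarrow> max_word J = max_word I \<and> cuts (words_of I) \<subseteq> cuts (words_of J)"
proof
  assume "refines J I"
  then show "max_word J = max_word I \<and> cuts (words_of I) \<subseteq> cuts (words_of J)"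
    using max_word_refines cuts_mono_groups unfolding refines_def by metis
next
  assume "max_word J = max_word I \<and> cuts (words_of I) \<subseteq> cuts (words_of J)"
  then show "refines J I"
    unfolding refines_def max_word_def by (intro groups_if_cuts_subset) auto
qed

text \<open>Non-empty groups that contain together no more words than there are groups must all be
  singletons.\<close>

lemma map_concat_eq_concat:
  assumes "[] \<notin> set groups" and "length (concat groups) \<le> length groups"
  shows "map concat groups = concat groups"
proof -
  have len: "length gs \<le> length (concat gs)" if "[] \<notin> set gs" for gs :: "'a list list list"
    using that
  proof (induction gs)
    case (Cons g gs)
    then show ?case
      by (cases g) auto
  qed simp
  show ?thesis
    using assms
  proof (induction groups)
    case (Cons g gs)
    then obtain x xs where g: "g = x # xs"
      by (cases g) auto
    with Cons.prems have "length xs + length (concat gs) \<le> length gs"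
      by simp
    moreover have "length gs \<le> length (concat gs)"
      using Cons.prems by (intro len) simp
    ultimately have "length xs = 0"
      by linarith
    with Cons g show ?case
      by simp
  qed simp
qed

text \<open>The first claim compares the cardinalities of the cut sets; in the second every group is
  a single word. Hence the number of words grows strictly under proper refinement, which drives the
  inductions on ribbons.\<close>

lemma refines_length: "refines J I \<Longrightarrow> length (words_of I) \<le> length (words_of J)"
  and refines_length_eq:
    "\<lbrakk>refines J I; length (words_of J) \<le> length (words_of I)\<rbrakk> \<Longrightarrow> J = I"
proof -
  show "length (words_of I) \<le> length (words_of J)" if "refines J I"
  proof -
    have "cuts (words_of I) \<subseteq> cuts (words_of J)"
      using that by (simp add: refines_iff_cuts)
    moreover have "finite (cuts (words_of J))"
      by (rule card_ge_0_finite) (simp add: card_cuts)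
    ultimately show ?thesis
      using card_mono[of "cuts (words_of J)" "cuts (words_of I)"] by (simp add: card_cuts)
  qed
  show "J = I" if "refines J I" "length (words_of J) \<le> length (words_of I)"
  proof -
    from that(1) obtain groups where J: "concat groups = words_of J"
      and I: "map concat groups = words_of I"
      by (auto simp: refines_def)
    have "[] \<notin> set groups"
      using words_of_nonempty[of I] unfolding I[symmetric] by force
    moreover have "length (words_of I) = length groups"
      using I by (metis length_map)
    ultimately have "map concat groups = concat groups"
      using that(2) J by (intro map_concat_eq_concat) auto
    with I J show ?thesis
      by (simp add: words_of_inject)
  qed
qed

lemma refines_refl [simp]: "refines I I"
  by (simp add: refines_iff_cuts)

lemma sentence_eq_iff_cuts:
  "I = J \<longleftrightarrow> max_word I = max_word J \<and> cuts (words_of I) = cuts (words_of J)"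
proof
  assume "max_word I = max_word J \<and> cuts (words_of I) = cuts (words_of J)"
  then have "refines I J" "refines J I"
    by (auto simp: refines_iff_cuts)
  then show "I = J"
    by (intro refines_length_eq refines_length)
qed simp

text \<open>Induction on the letters: the tail is cut first, with all positions shifted by one. The
  new letter then becomes a word of its own if 1 lies in \<open>D\<close>, and is put in front of
  the first word otherwise.\<close>

lemma ex_words_with_cuts:
  assumes "{0, length w} \<subseteq> D" and "D \<subseteq> {0..length w}"
  shows "\<exists>ws. concat ws = w \<and> cuts ws = D \<and> [] \<notin> set ws"
  using assms
proof (induction w arbitrary: D)
  case Nil
  then show ?case
    by (intro exI[of _ "[]"]) auto
next
  case (Cons a w)
  \<comment> \<open>The tail always has the cut 0, even when \<open>D\<close> does not contain 1. In
    that case the merge with the first word deletes it again, whence \<open>D' - {0}\<close>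
    below.\<close>
  define D' where "D' = insert 0 {k. Suc k \<in> D}"
  have D: "insert 0 (Suc ` (if Suc 0 \<in> D then D' else D' - {0})) = D"
  proof (rule set_eqI)
    fix k
    show "k \<in> insert 0 (Suc ` (if Suc 0 \<in> D then D' else D' - {0})) \<longleftrightarrow> k \<in> D"
      using Cons.prems by (cases k) (auto simp: D'_def image_iff)
  qed
  obtain ws where ws: "concat ws = w" "cuts ws = D'" "[] \<notin> set ws"
    using Cons.IH[of D'] Cons.prems by (force simp: D'_def)
  show ?case
  proof (cases "Suc 0 \<in> D")
    case True
    have "cuts ([a] # ws) = D"
      using D True ws(2) by simp
    with ws show ?thesis
      by (intro exI[of _ "[a] # ws"]) simp
  next
    case False
    \<comment> \<open>For empty \<open>w\<close> the total length would be 1, which would then lie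
      in \<open>D\<close>.\<close>
    with Cons.prems(1) have "w \<noteq> []"
      by auto
    with ws(1) obtain v vs where v: "ws = v # vs"
      by (cases ws) auto
    with ws(3) have "v \<noteq> []"
      by auto
    then have "D' - {0} = (+) (length v) ` cuts vs"
      using ws(2) v by auto
    then have "cuts ((a # v) # vs) = D"
      using D False by (simp add: image_image)
    with ws v show ?thesis
      by (intro exI[of _ "(a # v) # vs"]) simp
  qed
qed

lemma ex_sentence_with_cuts:
  assumes "{0, length w} \<subseteq> D" and "D \<subseteq> {0..length w}"
  obtains I where "max_word I = w" and "cuts (words_of I) = D"
proof -
  obtain ws where ws: "concat ws = w" "cuts ws = D" "[] \<notin> set ws"
    using ex_words_with_cuts[OF assms] by blast
  then have "words_of (Sentence ws) = ws"
    by (simp add: Sentence_inverse)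
  with ws that[of "Sentence ws"] show thesis
    by (simp add: max_word_def)
qed

section \<open>The complement in terms of cuts\<close>

lemma cuts_sentence:
  "{0, letters I} \<subseteq> cuts (words_of I)" "cuts (words_of I) \<subseteq> {0..letters I}"
  using length_in_cuts[of "words_of I"] cuts_le unfolding letters_def max_word_def by fastforce+

lemma complement_props:
  shows max_word_complement [simp]: "max_word (complement I) = max_word I"
    and cuts_complement:
      "cuts (words_of (complement I)) = {0, letters I} \<union> ({0..letters I} - cuts (words_of I))"
proof -
  let ?P = "\<lambda>J. max_word J = max_word I \<and>
     (\<forall>k. 0 < k \<and> k < letters I \<longrightarrow> (separated J k \<longleftrightarrow> \<not> separated I k))"
  let ?D = "{0, letters I} \<union> ({0..letters I} - cuts (words_of I))"
  \<comment> \<open>At inner positions the predicate exchanges cuts and non-cuts, and the trivial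
    cuts are common to all sentences. So it fixes the whole cut set, which yields existence and
    uniqueness for the definite description.\<close>
  have P_iff: "?P J \<longleftrightarrow> max_word J = max_word I \<and> cuts (words_of J) = ?D" for J
  proof (cases "max_word J = max_word I")
    case True
    then have "letters J = letters I"
      by (simp add: letters_def)
    then have "{0, letters I} \<subseteq> cuts (words_of J)" "cuts (words_of J) \<subseteq> {0..letters I}"
      using cuts_sentence[of J] by auto
    moreover have "cuts (words_of J) = ?D \<longleftrightarrow>
      (\<forall>k. 0 < k \<and> k < letters I \<longrightarrow> (k \<in> cuts (words_of J) \<longleftrightarrow> k \<notin> cuts (words_of I)))"
      if "{0, letters I} \<subseteq> cuts (words_of J)" "cuts (words_of J) \<subseteq> {0..letters I}"
    proof
      assume *: "\<forall>k. 0 < k \<and> k < letters I \<longrightarrow> (k \<in> cuts (words_of J) \<longleftrightarrow> k \<notin> cuts (words_of I))"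
      show "cuts (words_of J) = ?D"
      proof (rule set_eqI)
        fix k
        consider "k = 0" | "k = letters I" | "0 < k" "k < letters I" | "k > letters I"
          by linarith
        then show "k \<in> cuts (words_of J) \<longleftrightarrow> k \<in> ?D"
          using * that by cases auto
      qed
    qed auto
    ultimately show ?thesis
      using True by (simp add: separated_iff_cuts)
  qed simp
  obtain J where J: "max_word J = max_word I" "cuts (words_of J) = ?D"
    by (rule ex_sentence_with_cuts[of "max_word I" ?D]) (auto simp: letters_def)
  have "?P (complement I)"
    unfolding complement_def
  proof (rule theI)
    show "?P J"
      using J P_iff by blast
    show "J' = J" if "?P J'" for J'
      using that J unfolding P_iff sentence_eq_iff_cuts[of J'] by simp
  qed
  then show "max_word (complement I) = max_word I"
    and "cuts (words_of (complement I)) = ?D"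
    unfolding P_iff by auto
qed

lemma letters_complement [simp]: "letters (complement I) = letters I"
  by (simp add: letters_def)

lemma complement_complement [simp]: "complement (complement I) = I"
proof -
  have "cuts (words_of (complement (complement I))) = cuts (words_of I)"
    using cuts_sentence[of I] unfolding cuts_complement letters_complement by blast
  then show ?thesis
    by (intro sentence_eq_iff_cuts[THEN iffD2]) simp
qed

text \<open>To contain all positions that are not cuts of \<open>K\<close> is to cover the whole
  interval together with the cuts of \<open>K\<close>; the trivial cuts are present in any
  case.\<close>

lemma refines_complement_iff:
  "refines J (complement K) \<longleftrightarrow>
    max_word J = max_word K \<and> cuts (words_of K) \<union> cuts (words_of J) = {0..letters K}"
proof (cases "max_word J = max_word K")
  case True
  then have "letters J = letters K"
    by (simp add: letters_def)
  then show ?thesis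
    using cuts_sentence[of J] cuts_sentence[of K] True
    unfolding refines_iff_cuts cuts_complement max_word_complement by auto
qed (simp add: refines_iff_cuts)

text \<open>The common refinements correspond to the sets between the union \<open>?U\<close> of
  both cut sets and the full interval. An alternating sum over such a Boolean interval vanishes
  unless it is a single point.\<close>

lemma sum_common_refinements:
  "(\<Sum>L | refines L K \<and> refines L J. (-1) ^ length (words_of L)) =
    (if refines J (complement K) then (-1) ^ letters K else (0 :: 'k::comm_ring_1))"
proof (cases "max_word J = max_word K")
  case True
  let ?n = "letters K"
  let ?U = "cuts (words_of K) \<union> cuts (words_of J)"
  let ?\<D> = "{D. D \<subseteq> {0..?n} \<and> ?U \<subseteq> D}"
  have n: "letters J = ?n"
    using True by (simp add: letters_def)
  have U: "{0, ?n} \<subseteq> ?U" "?U \<subseteq> {0..?n}"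
    using cuts_sentence[of J] cuts_sentence[of K] n by auto
  have "bij_betw (\<lambda>L. cuts (words_of L)) {L. refines L K \<and> refines L J} ?\<D>"
    unfolding bij_betw_def
  proof (intro conjI equalityI subsetI)
    show "inj_on (\<lambda>L. cuts (words_of L)) {L. refines L K \<and> refines L J}"
    proof (rule inj_onI)
      fix L L' assume "L \<in> {L. refines L K \<and> refines L J}" "L' \<in> {L. refines L K \<and> refines L J}"
        and "cuts (words_of L) = cuts (words_of L')"
      then show "L = L'"
        by (intro sentence_eq_iff_cuts[THEN iffD2]) (simp add: refines_iff_cuts)
    qed
  next
    fix D assume "D \<in> (\<lambda>L. cuts (words_of L)) ` {L. refines L K \<and> refines L J}"
    then obtain L where L: "D = cuts (words_of L)" "refines L K" "refines L J"
      by blast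
    then have "letters L = ?n"
      by (simp add: letters_def refines_iff_cuts)
    then show "D \<in> ?\<D>"
      using L cuts_sentence[of L] by (auto simp: refines_iff_cuts)
  next
    fix D assume D: "D \<in> ?\<D>"
    then have "{0, ?n} \<subseteq> D" "D \<subseteq> {0..?n}"
      using U by auto
    then obtain L where "max_word L = max_word K" "cuts (words_of L) = D"
      unfolding letters_def by (rule ex_sentence_with_cuts)
    then show "D \<in> (\<lambda>L. cuts (words_of L)) ` {L. refines L K \<and> refines L J}"
      using D True by (force simp: refines_iff_cuts)
  qed
  \<comment> \<open>The sign is negated because a sentence has one more cut than words.\<close>
  then have "(\<Sum>D\<in>?\<D>. - ((-1) ^ card D)) =
      (\<Sum>L | refines L K \<and> refines L J. - ((-1) ^ card (cuts (words_of L))) :: 'k)"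
    by (rule sum.reindex_bij_betw[symmetric])
  then have "(\<Sum>L | refines L K \<and> refines L J. (-1) ^ length (words_of L)) =
      - (\<Sum>D\<in>?\<D>. (-1) ^ card D :: 'k)"
    by (simp add: card_cuts sum_negf)
  also have "\<dots> = (if ?U = {0..?n} then (-1) ^ ?n else 0)"
  proof (cases "?U = {0..?n}")
    case True
    then have "?\<D> = {{0..?n}}"
      by auto
    then show ?thesis
      using True by simp
  next
    case False
    with U(2) have "?U \<subset> {0..?n}"
      by blast
    \<comment> \<open>Between a set and a proper superset lie as many sets of even as of odd
      cardinality.\<close>
    from card_subsupersets_even_odd[OF _ this]
    have "(\<Sum>D\<in>?\<D>. (-1) ^ card D :: 'k) = 0"
      by (intro sum_alternating_cancels) (simp_all add: conj_assoc)
    then show ?thesis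
      using False by simp
  qed
  finally show ?thesis
    using True by (simp add: refines_complement_iff)
next
  case False
  then have none: "{L. refines L K \<and> refines L J} = {}"
    by (auto simp: refines_iff_cuts)
  show ?thesis
    unfolding none using False by (simp add: refines_complement_iff)
qed


section \<open>Linear maps on free vector spaces\<close>

lemma scale_single: "scale c (Poly_Mapping.single i d) = Poly_Mapping.single i (c * d)"
  by (rule poly_mapping_eqI) (simp add: lookup_scale lookup_single when_def)

lemma poly_mapping_expand:
  "(\<Sum>i\<in>Poly_Mapping.keys x. scale (Poly_Mapping.lookup x i) (Poly_Mapping.single i 1)) = x"
proof (rule poly_mapping_eqI)
  fix k
  have "Poly_Mapping.lookup
      (\<Sum>i\<in>Poly_Mapping.keys x. scale (Poly_Mapping.lookup x i) (Poly_Mapping.single i 1)) k =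
    (\<Sum>i\<in>Poly_Mapping.keys x. if i = k then Poly_Mapping.lookup x i else 0)"
    by (simp add: lookup_sum lookup_scale lookup_single when_def if_distrib cong: if_cong)
  also have "\<dots> = Poly_Mapping.lookup x k"
    by (simp add: in_keys_iff)
  finally show "Poly_Mapping.lookup
      (\<Sum>i\<in>Poly_Mapping.keys x. scale (Poly_Mapping.lookup x i) (Poly_Mapping.single i 1)) k =
    Poly_Mapping.lookup x k" .
qed

lemma linear_expand:
  assumes "Vector_Spaces.linear scale s f"
  shows "f x = (\<Sum>i\<in>Poly_Mapping.keys x. s (Poly_Mapping.lookup x i) (f (Poly_Mapping.single i 1)))"
proof -
  interpret Vector_Spaces.linear scale s f
    by fact
  have "f x = f (\<Sum>i\<in>Poly_Mapping.keys x. scale (Poly_Mapping.lookup x i) (Poly_Mapping.single i 1))"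
    by (simp only: poly_mapping_expand)
  then show ?thesis
    by (simp only: sum scale)
qed

lemma linear_eqI:
  assumes "Vector_Spaces.linear scale s f" and "Vector_Spaces.linear scale s g"
    and "\<And>i. f (Poly_Mapping.single i 1) = g (Poly_Mapping.single i 1)"
  shows "f = g"
proof
  fix x
  show "f x = g x"
    unfolding linear_expand[OF assms(1), of x] linear_expand[OF assms(2), of x]
    by (simp only: assms(3))
qed

text \<open>Allows one common index set for several vectors, since the support of a sum or a
  multiple may shrink.\<close>

lemma lin_ext_superset:
  assumes "finite A" and "Poly_Mapping.keys x \<subseteq> A"
  shows "lin_ext f x = (\<Sum>i\<in>A. scale (Poly_Mapping.lookup x i) (f i))"
  unfolding lin_ext_def using assms
  by (intro sum.mono_neutral_left) (auto simp: in_keys_iff)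

lemma linear_lin_ext: "Vector_Spaces.linear scale scale (lin_ext f)"
proof -
  have "lin_ext f (x + y) = lin_ext f x + lin_ext f y" for x y
  proof -
    let ?A = "Poly_Mapping.keys x \<union> Poly_Mapping.keys y"
    have "Poly_Mapping.keys (x + y) \<subseteq> ?A"
      by (rule keys_add)
    then show ?thesis
      by (simp add: lin_ext_superset[of ?A] lookup_add poly_mapping_vs.scale_left_distrib
          sum.distrib)
  qed
  moreover have "lin_ext f (scale c x) = scale c (lin_ext f x)" for c x
  proof -
    have "Poly_Mapping.keys (scale c x) \<subseteq> Poly_Mapping.keys x"
      by (auto simp: in_keys_iff lookup_scale)
    then show ?thesis
      by (simp add: lin_ext_superset[of "Poly_Mapping.keys x"] lookup_scale
          poly_mapping_vs.scale_sum_right)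
  qed
  ultimately show ?thesis
    by (simp add: Vector_Spaces.linear_iff poly_mapping_vs.vector_space_axioms)
qed

lemma lin_ext_single [simp]: "lin_ext f (Poly_Mapping.single i 1) = f i"
  by (simp add: lin_ext_def)

lemma lin_ext_sum: "lin_ext f (\<Sum>i\<in>A. g i) = (\<Sum>i\<in>A. lin_ext f (g i))"
proof -
  interpret Vector_Spaces.linear scale scale "lin_ext f"
    by (rule linear_lin_ext)
  show ?thesis
    by (rule sum)
qed

lemma convolution_H:
  "convolution f g (H I) =
    (\<Sum>vs\<in>subsentences I. f (H (tilde (removed I vs))) * g (H (tilde vs)))"
  by (simp add: convolution_def coproduct_def lin_ext_H lin_ext_sum)

lemma linear_convolution: "Vector_Spaces.linear scale scale (convolution f g)"
  unfolding convolution_def[abs_def] coproduct_def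
  by (rule Vector_Spaces.linear_compose[OF linear_lin_ext linear_lin_ext, unfolded comp_def])

lemma linear_unit_counit: "Vector_Spaces.linear scale scale unit_counit"
  by (simp add: Vector_Spaces.linear_iff poly_mapping_vs.vector_space_axioms unit_counit_def
      lookup_add lookup_scale poly_mapping_vs.scale_left_distrib)


section \<open>The antipode\<close>

lemma words_of_tilde: "words_of (tilde ws) = filter (\<lambda>w. w \<noteq> []) ws"
  by (rule tilde.rep_eq)

lemma tilde_words_of [simp]: "tilde (words_of I) = I"
proof -
  have "filter (\<lambda>w. w \<noteq> []) (words_of I) = words_of I"
    using words_of_nonempty[of I] by (auto simp: filter_id_conv)
  then show ?thesis
    by (simp add: words_of_inject[symmetric] words_of_tilde)
qed

lemma tilde_append: "tilde (us @ vs) = tilde us + tilde vs"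
  by transfer simp

lemma tilde_Nil [simp]: "tilde [] = 0"
  by transfer simp

lemma tilde_Nil_word [simp]: "tilde [[]] = 0"
  by transfer simp

lemma letters_tilde: "letters (tilde ws) = length (concat ws)"
proof -
  have "concat (filter (\<lambda>w. w \<noteq> []) ws) = concat ws"
    by (induction ws) auto
  then show ?thesis
    by (simp add: letters_def max_word_def words_of_tilde)
qed

section \<open>The antipode on one-word sentences\<close>

definition factorizations :: "'a list \<Rightarrow> 'a list list set" where
  "factorizations w = {ws. concat ws = w \<and> [] \<notin> set ws}"

lemma factorizations_Nil [simp]: "factorizations [] = {[]}"
proof -
  have "ws = []" if "concat ws = []" "[] \<notin> set ws" for ws :: "'a list list"
    using that by (cases ws) auto
  then show ?thesis
    by (auto simp: factorizations_def)
qed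

text \<open>Splits off the last word; \<open>k\<close> is the position where it starts, and
  \<open>k < length w\<close> keeps it non-empty.\<close>

lemma bij_betw_factorizations_snoc:
  assumes "w \<noteq> []"
  shows "bij_betw (\<lambda>(k, ws). ws @ [drop k w])
    (SIGMA k:{..<length w}. factorizations (take k w)) (factorizations w)"
proof (rule bij_betw_byWitness[where f' = "\<lambda>ws. (length (concat (butlast ws)), butlast ws)"])
  show "(\<lambda>ws. (length (concat (butlast ws)), butlast ws)) ` factorizations w
    \<subseteq> (SIGMA k:{..<length w}. factorizations (take k w))"
  proof (intro image_subsetI)
    fix ws assume ws: "ws \<in> factorizations w"
    then have "ws \<noteq> []"
      using assms by (auto simp: factorizations_def)
    then obtain us u where us: "ws = us @ [u]"
      by (metis append_butlast_last_id)
    with ws show "(length (concat (butlast ws)), butlast ws)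
        \<in> (SIGMA k:{..<length w}. factorizations (take k w))"
      by (auto simp: factorizations_def)
  qed
  show "\<forall>ws\<in>factorizations w. (\<lambda>(k, ws). ws @ [drop k w]) (length (concat (butlast ws)), butlast ws) = ws"
  proof
    fix ws assume ws: "ws \<in> factorizations w"
    then have "ws \<noteq> []"
      using assms by (auto simp: factorizations_def)
    then obtain us u where us: "ws = us @ [u]"
      by (metis append_butlast_last_id)
    with ws show "(\<lambda>(k, ws). ws @ [drop k w]) (length (concat (butlast ws)), butlast ws) = ws"
      by (auto simp: factorizations_def)
  qed
qed (auto simp: factorizations_def)

text \<open>Splits off the first word; \<open>k\<close> is its length, so 0 is excluded.\<close>

lemma bij_betw_factorizations_Cons:
  assumes "w \<noteq> []"
  shows "bij_betw (\<lambda>(k, ws). take k w # ws)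
    (SIGMA k:{0<..length w}. factorizations (drop k w)) (factorizations w)"
proof (rule bij_betw_byWitness[where f' = "\<lambda>ws. (length (hd ws), tl ws)"])
  show "(\<lambda>ws. (length (hd ws), tl ws)) ` factorizations w
    \<subseteq> (SIGMA k:{0<..length w}. factorizations (drop k w))"
  proof (intro image_subsetI)
    fix ws assume ws: "ws \<in> factorizations w"
    then show "(length (hd ws), tl ws) \<in> (SIGMA k:{0<..length w}. factorizations (drop k w))"
      using assms by (cases ws) (auto simp: factorizations_def)
  qed
  show "\<forall>ws\<in>factorizations w. (\<lambda>(k, ws). take k w # ws) (length (hd ws), tl ws) = ws"
  proof
    fix ws assume ws: "ws \<in> factorizations w"
    then show "(\<lambda>(k, ws). take k w # ws) (length (hd ws), tl ws) = ws"
      using assms by (cases ws) (auto simp: factorizations_def)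
  qed
qed (auto simp: factorizations_def)

lemma finite_factorizations: "finite (factorizations w)"
proof (induction w rule: length_induct)
  case (1 w)
  show ?case
  proof (cases "w = []")
    case False
    have "finite (SIGMA k:{..<length w}. factorizations (take k w))"
      using 1 by (intro finite_SigmaI) auto
    then show ?thesis
      using bij_betw_finite[OF bij_betw_factorizations_snoc[OF False]] by simp
  qed simp
qed

text \<open>The closed form of the antipode of \<open>H\<close> at the one-word sentence, obtained
  by unfolding the recursion that the convolution identity imposes.\<close>

definition word_antipode :: "'a list \<Rightarrow> ('a, 'k::field) nsym" where
  "word_antipode w = (\<Sum>ws\<in>factorizations w. Poly_Mapping.single (tilde ws) ((-1) ^ length ws))"

lemma word_antipode_Nil [simp]: "word_antipode [] = 1"
  by (simp add: word_antipode_def)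

text \<open>Factorizations are grouped by their last word, which contributes one factor
  \<open>H\<close> and one sign. This is the recursion needed for \<open>convolution S id\<close>;
  splitting off the first word gives the one for \<open>convolution id S\<close>.\<close>

lemma word_antipode_snoc:
  assumes "w \<noteq> []"
  shows "(word_antipode w :: ('a, 'k::field) nsym) =
    - (\<Sum>k<length w. word_antipode (take k w) * H (tilde [drop k w]))"
proof -
  have "(word_antipode w :: ('a, 'k) nsym) = (\<Sum>(k, ws)\<in>(SIGMA k:{..<length w}. factorizations (take k w)).
      Poly_Mapping.single (tilde (ws @ [drop k w])) ((-1) ^ Suc (length ws)))"
    unfolding word_antipode_def
    by (subst sum.reindex_bij_betw[OF bij_betw_factorizations_snoc[OF assms], symmetric])
      (simp add: case_prod_unfold)
  also have "\<dots> = (\<Sum>k<length w. \<Sum>ws\<in>factorizations (take k w).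
      Poly_Mapping.single (tilde (ws @ [drop k w])) ((-1) ^ Suc (length ws)))"
    by (rule sum.Sigma[symmetric]) (auto simp: finite_factorizations)
  also have "\<dots> = (\<Sum>k<length w. - (word_antipode (take k w) * H (tilde [drop k w])))"
    by (simp add: word_antipode_def H_def sum_distrib_right mult_single tilde_append
        single_uminus sum_negf)
  finally show ?thesis
    by (simp add: sum_negf)
qed

lemma word_antipode_Cons:
  assumes "w \<noteq> []"
  shows "(word_antipode w :: ('a, 'k::field) nsym) =
    - (\<Sum>k\<in>{0<..length w}. H (tilde [take k w]) * word_antipode (drop k w))"
proof -
  have summand: "Poly_Mapping.single (tilde (take k w # ws)) ((-1) ^ Suc n) =
      - (H (tilde [take k w]) * Poly_Mapping.single (tilde ws) ((-1) ^ n) :: ('a, 'k) nsym)" for k ws n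
    using tilde_append[of "[take k w]" ws] by (simp add: H_def mult_single single_uminus)
  have "(word_antipode w :: ('a, 'k) nsym) = (\<Sum>(k, ws)\<in>(SIGMA k:{0<..length w}. factorizations (drop k w)).
      Poly_Mapping.single (tilde (take k w # ws)) ((-1) ^ Suc (length ws)))"
    unfolding word_antipode_def
    by (subst sum.reindex_bij_betw[OF bij_betw_factorizations_Cons[OF assms], symmetric])
      (simp add: case_prod_unfold)
  also have "\<dots> = (\<Sum>k\<in>{0<..length w}. \<Sum>ws\<in>factorizations (drop k w).
      Poly_Mapping.single (tilde (take k w # ws)) ((-1) ^ Suc (length ws)))"
    by (rule sum.Sigma[symmetric]) (auto simp: finite_factorizations)
  also have "\<dots> = (\<Sum>k\<in>{0<..length w}. - (H (tilde [take k w]) * word_antipode (drop k w)))"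
    by (simp only: word_antipode_def sum_distrib_left summand sum_negf)
  finally show ?thesis
    by (simp add: sum_negf)
qed

lemma H_0: "H 0 = 1"
  by (simp add: H_def)

lemma sum_suffixes:
  "(\<Sum>v | suffix v w. f (take (length w - length v) w) v) = (\<Sum>k\<le>length w. f (take k w) (drop k w))"
proof -
  have "bij_betw (\<lambda>k. drop k w) {..length w} {v. suffix v w}"
  proof (rule bij_betw_byWitness[where f' = "\<lambda>v. length w - length v"])
    show "\<forall>v\<in>{v. suffix v w}. drop (length w - length v) w = v"
      by (auto simp: suffix_def)
  qed (auto simp: suffix_drop)
  from sum.reindex_bij_betw[OF this, symmetric, of "\<lambda>v. f (take (length w - length v) w) v"]
  show ?thesis
    by simp
qed

text \<open>The term with empty suffix is \<open>word_antipode w\<close>, and by the recursion the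
  others sum to its negative.\<close>

lemma sum_word_antipode_left:
  assumes "w \<noteq> []"
  shows "(\<Sum>v | suffix v w. word_antipode (take (length w - length v) w) * H (tilde [v])) = 0"
proof -
  have "{..length w} = insert (length w) {..<length w}"
    by auto
  then show ?thesis
    by (simp add: sum_suffixes[of "\<lambda>u v. word_antipode u * H (tilde [v])"] H_0
        word_antipode_snoc[OF assms, symmetric])
      (subst word_antipode_snoc[OF assms], simp)
qed

text \<open>Here \<open>word_antipode w\<close> is the term whose suffix is all of \<open>w\<close>,
  and the recursion on the first word cancels it.\<close>

lemma sum_word_antipode_right:
  assumes "w \<noteq> []"
  shows "(\<Sum>v | suffix v w. H (tilde [take (length w - length v) w]) * word_antipode v) = 0"
proof -
  have "{..length w} = insert 0 {0<..length w}"
    by auto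
  then show ?thesis
    by (simp add: sum_suffixes[of "\<lambda>u v. H (tilde [u]) * word_antipode v"] H_0)
      (subst word_antipode_Cons[OF assms], simp)
qed

section \<open>Antihomomorphic extension to sentences and the convolution identities\<close>

definition sentence_antipode :: "'a sentence \<Rightarrow> ('a, 'k::field) nsym" where
  "sentence_antipode I = prod_list (map word_antipode (rev (words_of I)))"

text \<open>Empty words contribute the factor 1, so their deletion in the coproduct can be
  ignored.\<close>

lemma sentence_antipode_tilde:
  "sentence_antipode (tilde ws) = prod_list (map word_antipode (rev ws))"
proof -
  have "prod_list (map word_antipode (filter (\<lambda>w. w \<noteq> []) us)) =
      (prod_list (map word_antipode us) :: ('a, 'k::field) nsym)" for us :: "'a list list"
    by (induction us) auto
  then show ?thesis
    by (simp add: sentence_antipode_def words_of_tilde rev_filter)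
qed

text \<open>The suffix of the first word is chosen independently of the others, which turns the
  coproduct into a double sum. The analogue for the last word serves the convolution in the other
  order.\<close>

lemma subsentences_cases:
  assumes "I \<noteq> 0"
  obtains w ws where "words_of I = w # ws" and "w \<noteq> []"
    and "subsentences I = (\<lambda>(v, vs). v # vs) ` ({v. suffix v w} \<times> {vs. list_all2 suffix vs ws})"
proof -
  have "words_of I \<noteq> []"
    using assms by (metis words_of_inject zero_sentence.rep_eq)
  then obtain w ws where I: "words_of I = w # ws"
    by (cases "words_of I") auto
  moreover have "w \<noteq> []"
    using words_of_nonempty[of I] I by auto
  moreover have "subsentences I =
      (\<lambda>(v, vs). v # vs) ` ({v. suffix v w} \<times> {vs. list_all2 suffix vs ws})"
    by (auto simp: subsentences_def I list_all2_Cons2)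
  ultimately show thesis
    by (rule that)
qed

lemma subsentences_snoc_cases:
  assumes "I \<noteq> 0"
  obtains w ws where "words_of I = ws @ [w]" and "w \<noteq> []"
    and "subsentences I = (\<lambda>(v, vs). vs @ [v]) ` ({v. suffix v w} \<times> {vs. list_all2 suffix vs ws})"
proof -
  have "words_of I \<noteq> []"
    using assms by (metis words_of_inject zero_sentence.rep_eq)
  then obtain w ws where I: "words_of I = ws @ [w]"
    by (metis append_butlast_last_id)
  moreover have "w \<noteq> []"
    using words_of_nonempty[of I] I by auto
  moreover have "subsentences I =
      (\<lambda>(v, vs). vs @ [v]) ` ({v. suffix v w} \<times> {vs. list_all2 suffix vs ws})"
    by (force simp: subsentences_def I list_all2_append2 list_all2_Cons2
        intro: list_all2_appendI dest: list_all2_lengthD)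
  ultimately show thesis
    by (rule that)
qed

lemma subsentences_0: "subsentences 0 = {[]}"
  by (auto simp: subsentences_def zero_sentence.rep_eq)

lemma removed_0: "removed 0 vs = []"
  by (simp add: removed_def zero_sentence.rep_eq)

lemma unit_counit_H: "unit_counit (H I) = (if I = 0 then 1 else 0)"
  by (simp add: unit_counit_def H_def lookup_single)

text \<open>In the sums over \<open>J\<close> the two factors coming from the first (respectively last) word of \<open>I\<close>
  are adjacent, so they already cancel for this single word.\<close>

lemma convolution_antipode_left: "convolution (lin_ext sentence_antipode) id (H I) = unit_counit (H I)"
proof (cases "I = 0")
  case True
  show ?thesis
    unfolding True convolution_H subsentences_0 removed_0 unit_counit_H
    by (simp add: lin_ext_H[of _ 0, unfolded H_0] sentence_antipode_def zero_sentence.rep_eq H_0)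
next
  case False
  then obtain w ws where I: "words_of I = w # ws" and w: "w \<noteq> []"
    and sub: "subsentences I = (\<lambda>(v, vs). v # vs) ` ({v. suffix v w} \<times> {vs. list_all2 suffix vs ws})"
    by (rule subsentences_cases)
  let ?P = "\<lambda>vs. prod_list (map word_antipode (rev (map2 (\<lambda>w v. take (length w - length v) w) ws vs)))"
  let ?u = "\<lambda>v. word_antipode (take (length w - length v) w)"
  have summand: "lin_ext sentence_antipode (H (tilde (removed I (v # vs)))) * id (H (tilde (v # vs))) =
      ?P vs * ?u v * (H (tilde [v]) * H (tilde vs))" for v vs
    using tilde_append[of "[v]" vs]
    by (simp add: lin_ext_H removed_def I sentence_antipode_tilde H_mult mult.assoc)
  have "convolution (lin_ext sentence_antipode) id (H I) =
      (\<Sum>(v, vs)\<in>{v. suffix v w} \<times> {vs. list_all2 suffix vs ws}.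
        ?P vs * ?u v * (H (tilde [v]) * H (tilde vs)))"
    unfolding convolution_H sub
    by (subst sum.reindex)
      (auto simp: inj_on_def summand simp del: id_apply intro!: sum.cong)
  also have "\<dots> = (\<Sum>vs | list_all2 suffix vs ws. \<Sum>v | suffix v w.
        ?P vs * ?u v * (H (tilde [v]) * H (tilde vs)))"
    unfolding sum.cartesian_product[symmetric] by (rule sum.swap)
  also have "\<dots> = (\<Sum>vs | list_all2 suffix vs ws.
        ?P vs * (\<Sum>v | suffix v w. ?u v * H (tilde [v])) * H (tilde vs))"
    by (simp add: sum_distrib_left sum_distrib_right mult.assoc)
  finally show ?thesis
    using False by (simp add: sum_word_antipode_left[OF w] unit_counit_H)
qed

lemma convolution_antipode_right: "convolution id (lin_ext sentence_antipode) (H I) = unit_counit (H I)"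
proof (cases "I = 0")
  case True
  show ?thesis
    unfolding True convolution_H subsentences_0 removed_0 unit_counit_H
    by (simp add: lin_ext_H[of _ 0, unfolded H_0] sentence_antipode_def zero_sentence.rep_eq H_0)
next
  case False
  then obtain w ws where I: "words_of I = ws @ [w]" and w: "w \<noteq> []"
    and sub: "subsentences I = (\<lambda>(v, vs). vs @ [v]) ` ({v. suffix v w} \<times> {vs. list_all2 suffix vs ws})"
    by (rule subsentences_snoc_cases)
  let ?P = "\<lambda>vs. H (tilde (map2 (\<lambda>w v. take (length w - length v) w) ws vs))"
  let ?Q = "\<lambda>vs. prod_list (map word_antipode (rev vs))"
  let ?u = "\<lambda>v. H (tilde [take (length w - length v) w])"
  have removed: "removed I (vs @ [v]) =
      map2 (\<lambda>w v. take (length w - length v) w) ws vs @ [take (length w - length v) w]"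
    if "list_all2 suffix vs ws" for v vs
    using list_all2_lengthD[OF that] by (simp add: removed_def I)
  have "convolution id (lin_ext sentence_antipode) (H I) =
      (\<Sum>(v, vs)\<in>{v. suffix v w} \<times> {vs. list_all2 suffix vs ws}.
        ?P vs * ?u v * (word_antipode v * ?Q vs))"
    unfolding convolution_H sub
    by (subst sum.reindex)
      (auto simp: inj_on_def lin_ext_H removed sentence_antipode_tilde tilde_append
        H_mult[symmetric] intro!: sum.cong)
  also have "\<dots> = (\<Sum>vs | list_all2 suffix vs ws. \<Sum>v | suffix v w.
        ?P vs * ?u v * (word_antipode v * ?Q vs))"
    unfolding sum.cartesian_product[symmetric] by (rule sum.swap)
  also have "\<dots> = (\<Sum>vs | list_all2 suffix vs ws.
        ?P vs * (\<Sum>v | suffix v w. ?u v * word_antipode v) * ?Q vs)"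
    by (simp add: sum_distrib_left sum_distrib_right mult.assoc)
  finally show ?thesis
    using False by (simp add: sum_word_antipode_right[OF w] unit_counit_H)
qed

lemma is_antipode_sentence_antipode: "is_antipode (lin_ext sentence_antipode)"
  unfolding is_antipode_def
proof (intro conjI linear_lin_ext)
  show "convolution (lin_ext sentence_antipode) id = unit_counit"
    using convolution_antipode_left unfolding H_def
    by (intro linear_eqI[OF linear_convolution linear_unit_counit])
  show "convolution id (lin_ext sentence_antipode) = unit_counit"
    using convolution_antipode_right unfolding H_def
    by (intro linear_eqI[OF linear_convolution linear_unit_counit])
qed

section \<open>Uniqueness of the antipode\<close>

lemma letters_removed:
  assumes "vs \<in> subsentences I"
  shows "letters (tilde (removed I vs)) + length (concat vs) = letters I"
proof -
  have "length (concat (map2 (\<lambda>w v. take (length w - length v) w) ws vs)) + length (concat vs) =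
      length (concat ws)" if "list_all2 suffix vs ws" for ws
    using that by (induction rule: list_all2_induct) (auto dest: suffix_length_le)
  with assms show ?thesis
    by (simp add: subsentences_def removed_def letters_tilde)
      (simp add: letters_def max_word_def)
qed

text \<open>In \<open>convolution S id (H I)\<close> exactly one term has a left factor of full
  degree, namely \<open>S (H I)\<close> times 1. The equation thus determines \<open>S (H I)\<close>
  from values in lower degree.\<close>

lemma is_antipode_unique:
  fixes S T :: "('a, 'k::field) nsym \<Rightarrow> ('a, 'k) nsym"
  assumes "is_antipode S" and "is_antipode T"
  shows "S = T"
proof -
  have "S (H I) = T (H I)" for I
  proof (induction "letters I" arbitrary: I rule: less_induct)
    case less
    \<comment> \<open>Taking the empty suffix of every word leaves \<open>I\<close> on the left and
      the empty sentence on the right.\<close>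
    let ?vs = "map (\<lambda>_. []) (words_of I)"
    have empty: "?vs \<in> subsentences I" "tilde (removed I ?vs) = I" "tilde ?vs = 0"
    proof -
      show "?vs \<in> subsentences I"
        by (simp add: subsentences_def list_all2_conv_all_nth)
      have "map2 (\<lambda>w v. take (length w - length v) w) ws (map (\<lambda>_. [] :: 'a list) ws) = ws"
        for ws :: "'a list list"
        by (induction ws) auto
      then show "tilde (removed I ?vs) = I"
        by (simp only: removed_def tilde_words_of)
      show "tilde ?vs = 0"
        by (simp add: words_of_inject[symmetric] words_of_tilde zero_sentence.rep_eq)
    qed
    \<comment> \<open>Any other choice moves at least one letter to the right factor, and the
      coproduct preserves the total number of letters.\<close>
    have "letters (tilde (removed I vs)) < letters I" if "vs \<in> subsentences I - {?vs}" for vs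
    proof -
      have "concat vs \<noteq> []"
      proof
        assume "concat vs = []"
        then have "\<forall>v\<in>set vs. v = []"
          by auto
        moreover have "length vs = length (words_of I)"
          using that by (auto simp: subsentences_def dest: list_all2_lengthD)
        ultimately have "vs = ?vs"
          unfolding map_replicate_const by (intro replicate_eqI) auto
        with that show False
          by simp
      qed
      then have "0 < length (concat vs)"
        by (rule length_greater_0_conv[THEN iffD2])
      moreover have "letters (tilde (removed I vs)) + length (concat vs) = letters I"
        using that by (intro letters_removed) simp
      ultimately show ?thesis
        by linarith
    qed
    then have "(\<Sum>vs\<in>subsentences I - {?vs}. S (H (tilde (removed I vs))) * id (H (tilde vs))) =
        (\<Sum>vs\<in>subsentences I - {?vs}. T (H (tilde (removed I vs))) * id (H (tilde vs)))"
      using less by (intro sum.cong) auto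
    moreover have "convolution S id (H I) = convolution T id (H I)"
      using assms by (simp add: is_antipode_def)
    ultimately show ?case
      by (simp add: convolution_H sum.remove[OF finite_subsentences empty(1)] empty(2,3) H_0)
  qed
  then show ?thesis
    using assms unfolding H_def is_antipode_def by (intro linear_eqI) auto
qed

lemma antipode_eq: "antipode = lin_ext sentence_antipode"
  unfolding antipode_def
  by (rule the_equality[of is_antipode, OF is_antipode_sentence_antipode])
    (rule is_antipode_unique[OF _ is_antipode_sentence_antipode])

section \<open>The antipode after reversal on the basis \<open>H\<close>\<close>

lemma prod_list_word_antipode:
  "(prod_list (map word_antipode ws) :: ('a, 'k::field) nsym) =
    (\<Sum>vs\<in>{concat groups |groups. map concat groups = ws \<and> [] \<notin> set (concat groups)}.
      Poly_Mapping.single (tilde vs) ((-1) ^ length vs))"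
proof (induction ws)
  case Nil
  have "{concat groups |groups. map concat groups = [] \<and> [] \<notin> set (concat groups)} = {[]}"
    by auto
  then show ?case
    by simp
next
  case (Cons w ws)
  let ?R = "\<lambda>ws. {concat groups |groups. map concat groups = ws \<and> [] \<notin> set (concat groups)}"
  have image: "?R (w # ws) = (\<lambda>(g, vs). g @ vs) ` (factorizations w \<times> ?R ws)"
  proof (intro equalityI subsetI)
    fix vs assume "vs \<in> ?R (w # ws)"
    then obtain g groups where "vs = g @ concat groups" "concat g = w" "map concat groups = ws"
      "[] \<notin> set g" "[] \<notin> set (concat groups)"
      by (force simp: map_eq_Cons_conv)
    then show "vs \<in> (\<lambda>(g, vs). g @ vs) ` (factorizations w \<times> ?R ws)"
      by (force simp: factorizations_def)
  next
    fix vs assume "vs \<in> (\<lambda>(g, vs). g @ vs) ` (factorizations w \<times> ?R ws)"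
    then obtain g groups where vs: "vs = g @ concat groups" "concat g = w" "map concat groups = ws"
      "[] \<notin> set g" "[] \<notin> set (concat groups)"
      by (auto simp: factorizations_def)
    then show "vs \<in> ?R (w # ws)"
      by (intro CollectI exI[of _ "g # groups"]) auto
  qed
  \<comment> \<open>Two factorizations of \<open>w\<close> of which one is a prefix of the other
    differ by non-empty words with empty concatenation, so they agree. Hence no term of the expanded
    product is counted twice.\<close>
  have inj: "inj_on (\<lambda>(g, vs). g @ vs) (factorizations w \<times> ?R ws)"
  proof -
    have "g = g'" if "g @ vs = g' @ vs'" "g \<in> factorizations w" "g' \<in> factorizations w"
      for g g' vs vs'
    proof -
      have Nil: "x = []" if "concat x = []" "[] \<notin> set x" for x :: "'a list list"
        using that by (cases x) auto
      from that(1) obtain us where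
        "g = g' @ us \<and> us @ vs = vs' \<or> g @ us = g' \<and> vs = us @ vs'"
        unfolding append_eq_append_conv2 by (rule exE)
      then show ?thesis
      proof (elim disjE conjE)
        assume g: "g = g' @ us"
        with that(2,3) have "us = []"
          by (intro Nil) (simp_all add: factorizations_def)
        with g show ?thesis
          by simp
      next
        assume g: "g @ us = g'"
        with that(2,3) have "us = []"
          by (intro Nil) (auto simp: factorizations_def)
        with g show ?thesis
          by simp
      qed
    qed
    then have eq: "g = g' \<and> vs = vs'" if "g @ vs = g' @ vs'" "g \<in> factorizations w" "g' \<in> factorizations w"
      for g g' vs vs'
    proof -
      from that have "g = g'"
        by fact
      with that(1) show ?thesis
        by simp
    qed
    show ?thesis
    proof (rule inj_onI)
      fix p q assume "p \<in> factorizations w \<times> ?R ws" "q \<in> factorizations w \<times> ?R ws"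
        and "(\<lambda>(g, vs). g @ vs) p = (\<lambda>(g, vs). g @ vs) q"
      then show "p = q"
        using eq[of "fst p" "snd p" "fst q" "snd q"]
        by (simp add: mem_Times_iff case_prod_unfold prod_eq_iff)
    qed
  qed
  have "(prod_list (map word_antipode (w # ws)) :: ('a, 'k) nsym) =
      (\<Sum>g\<in>factorizations w. \<Sum>vs\<in>?R ws. Poly_Mapping.single (tilde (g @ vs)) ((-1) ^ length (g @ vs)))"
    unfolding list.map prod_list.Cons Cons.IH word_antipode_def[of w] sum_product
    by (simp only: mult_single tilde_append length_append power_add)
  then show ?case
    unfolding image sum.reindex[OF inj] sum.cartesian_product
    by (simp add: case_prod_unfold comp_def)
qed

text \<open>The reversal undoes the change of order made by the antipode. What remains is the
  product over the words in their original order, and choosing a factorization of each word is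
  choosing a refinement.\<close>

lemma antipode_reversal_H:
  "antipode (reversal_map (H J) :: ('a, 'k::field) nsym) =
    (\<Sum>L | refines L J. Poly_Mapping.single L ((-1) ^ length (words_of L)))"
proof -
  have image: "words_of ` {L. refines L J} =
      {concat groups |groups. map concat groups = words_of J \<and> [] \<notin> set (concat groups)}"
  proof (intro equalityI subsetI)
    fix vs assume "vs \<in> words_of ` {L. refines L J}"
    then obtain L groups where "vs = words_of L" "concat groups = words_of L"
      "map concat groups = words_of J"
      unfolding refines_def by blast
    then show "vs \<in> {concat groups |groups. map concat groups = words_of J \<and> [] \<notin> set (concat groups)}"
      by (intro CollectI exI[of _ groups]) (simp del: set_concat)
  next
    fix vs assume "vs \<in> {concat groups |groups. map concat groups = words_of J \<and> [] \<notin> set (concat groups)}"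
    then obtain groups where "vs = concat groups" "map concat groups = words_of J" "[] \<notin> set vs"
      by auto
    moreover from \<open>[] \<notin> set vs\<close> have "words_of (Sentence vs) = vs"
      by (simp add: Sentence_inverse)
    ultimately show "vs \<in> words_of ` {L. refines L J}"
      by (intro image_eqI[of _ _ "Sentence vs"]) (auto simp: refines_def)
  qed
  have "antipode (reversal_map (H J) :: ('a, 'k) nsym) = prod_list (map word_antipode (words_of J))"
    by (simp add: antipode_eq reversal_map_def lin_ext_H sentence_antipode_def reversal.rep_eq)
  also have "\<dots> = (\<Sum>vs\<in>words_of ` {L. refines L J}. Poly_Mapping.single (tilde vs) ((-1) ^ length vs))"
    unfolding image by (rule prod_list_word_antipode)
  also have "\<dots> = (\<Sum>L | refines L J. Poly_Mapping.single L ((-1) ^ length (words_of L)))"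
    by (subst sum.reindex) (auto simp: inj_on_def words_of_inject)
  finally show ?thesis .
qed


section \<open>Ribbons\<close>

lemma linear_F: "Vector_Spaces.linear scale (*) (F I)"
  by (rule functional_linearI)
    (simp_all add: F_def M_def lookup_add lookup_scale sum.distrib sum_distrib_left)

lemma F_H: "F I (H J) = (if refines J I then 1 else 0)"
proof -
  have "F I (H J) = (\<Sum>K | refines K I. if K = J then 1 else 0)"
    by (simp add: F_def M_H)
  then show ?thesis
    by (simp add: finite_refinements)
qed

section \<open>Fundamental functions and their dual basis\<close>

lemma length_words_of_le: "length (words_of I) \<le> letters I"
  using card_mono[OF _ cuts_sentence(2)[of I]] by (simp add: card_cuts)

text \<open>The change of basis from \<open>M\<close> to \<open>F\<close> is unitriangular with
  respect to refinement, so the coefficients can be recovered from the finest sentences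
  upwards.\<close>

lemma F_separates:
  assumes "\<And>I. F I x = F I y"
  shows "x = y"
proof (rule poly_mapping_eqI)
  fix I
  show "Poly_Mapping.lookup x I = Poly_Mapping.lookup y I"
  \<comment> \<open>The measure counts the inner positions that are not yet cut; it drops under
    proper refinement.\<close>
  proof (induction "letters I - length (words_of I)" arbitrary: I rule: less_induct)
    case less
    have "letters J - length (words_of J) < letters I - length (words_of I)"
      if "J \<in> {J. refines J I} - {I}" for J
    proof -
      have "length (words_of I) < length (words_of J)"
        using that refines_length_eq[of J I] by force
      moreover have "letters J = letters I"
        using that max_word_refines[of J I] by (simp add: letters_def)
      ultimately show ?thesis
        using length_words_of_le[of J] by linarith
    qed
    then have rest: "(\<Sum>J\<in>{J. refines J I} - {I}. M J x) = (\<Sum>J\<in>{J. refines J I} - {I}. M J y)"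
      using less by (intro sum.cong) (auto simp: M_def)
    have F: "F I z = M I z + (\<Sum>J\<in>{J. refines J I} - {I}. M J z)" for z
      unfolding F_def by (rule sum.remove) (simp_all add: finite_refinements)
    from rest have "M I x = M I y"
      using assms[of I] unfolding F[of x] F[of y] by simp
    then show ?case
      by (simp add: M_def)
  qed
qed

lemma finite_coarsenings: "finite {I. refines J I}"
proof (rule finite_imageD)
  have "finite (cuts (words_of J))"
    by (rule card_ge_0_finite) (simp add: card_cuts)
  then show "finite ((\<lambda>I. cuts (words_of I)) ` {I. refines J I})"
    by (rule finite_subset[rotated, OF finite_Pow_iff[THEN iffD2]]) (auto simp: refines_iff_cuts)
  show "inj_on (\<lambda>I. cuts (words_of I)) {I. refines J I}"
    by (intro inj_onI sentence_eq_iff_cuts[THEN iffD2]) (auto simp: refines_iff_cuts)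
qed

text \<open>Dualising $F_I = \sum_{J \preccurlyeq I} M_J$ gives $H_J = \sum_{J \preccurlyeq I} R_I$,
  which determines $R_J$ recursively from the strictly coarser ribbons.\<close>

lemma ex_dual_F: "\<exists>r :: ('a, 'k::field) nsym. \<forall>I. F I r = (if I = J then 1 else 0)"
proof (induction "length (words_of J)" arbitrary: J rule: less_induct)
  case less
  let ?C = "{I. refines J I} - {J}"
  have "\<forall>I\<in>?C. \<exists>r :: ('a, 'k) nsym. \<forall>K. F K r = (if K = I then 1 else 0)"
  proof
    fix I assume "I \<in> ?C"
    then have "length (words_of I) < length (words_of J)"
      using refines_length_eq[of J I] by force
    then show "\<exists>r :: ('a, 'k) nsym. \<forall>K. F K r = (if K = I then 1 else 0)"
      by (rule less)
  qed
  then obtain r :: "'a sentence \<Rightarrow> ('a, 'k) nsym"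
    where r: "\<And>I K. I \<in> ?C \<Longrightarrow> F K (r I) = (if K = I then 1 else 0)"
    by metis
  have "F K (H J - (\<Sum>I\<in>?C. r I)) = (if K = J then 1 else 0)" for K
  proof -
    interpret Vector_Spaces.linear scale "(*)" "F K :: ('a, 'k) nsym \<Rightarrow> 'k"
      by (rule linear_F)
    have "F K (H J - (\<Sum>I\<in>?C. r I)) =
        (if refines J K then 1 else 0) - (\<Sum>I\<in>?C. if K = I then 1 else 0)"
      by (simp add: diff sum F_H r)
    \<comment> \<open>The sum is 1 precisely when \<open>K\<close> is strictly coarser than
      \<open>J\<close>, so only \<open>K = J\<close> survives the subtraction.\<close>
    also have "\<dots> = (if K = J then 1 else 0)"
      using finite_coarsenings[of J] by auto
    finally show ?thesis .
  qed
  then show ?case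
    by blast
qed

text \<open>Justifies the definite description: a dual family is chosen member by member, and it is
  unique because the \<open>F I\<close> separate points.\<close>

lemma F_R: "F I (R J :: ('a, 'k::field) nsym) = (if I = J then 1 else 0)"
proof -
  let ?P = "\<lambda>r :: 'a sentence \<Rightarrow> ('a, 'k) nsym. \<forall>I J. F I (r J) = (if I = J then 1 else 0)"
  obtain r where r: "?P r"
    using ex_dual_F by metis
  have "?P R"
    unfolding R_def
  proof (rule theI[of ?P, OF r])
    fix r' assume "?P r'"
    with r show "r' = r"
      by (intro ext F_separates) simp
  qed
  then show ?thesis
    by blast
qed

section \<open>Adjointness and the action on ribbons\<close>

lemma F_antipode_reversal:
  fixes x :: "('a, 'k::field) nsym"
  shows "F K (antipode (reversal_map x)) = (-1) ^ letters K * F (complement K) x"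
proof -
  let ?f = "\<lambda>x :: ('a, 'k) nsym. F K (antipode (reversal_map x))"
  let ?g = "\<lambda>x :: ('a, 'k) nsym. (-1) ^ letters K * F (complement K) x"
  \<comment> \<open>Both sides are linear in \<open>x\<close>, so it suffices to compare them on the
    basis \<open>H\<close>.\<close>
  have "?f = ?g"
  proof (rule linear_eqI)
    show "Vector_Spaces.linear scale (*) ?f"
      unfolding antipode_eq reversal_map_def
      using Vector_Spaces.linear_compose[OF Vector_Spaces.linear_compose[OF linear_lin_ext linear_lin_ext] linear_F]
      by (simp add: comp_def)
    show "Vector_Spaces.linear scale (*) ?g"
      by (rule functional_linearI)
        (simp_all add: F_def M_def lookup_add lookup_scale sum.distrib sum_distrib_left algebra_simps)
  next
    fix J :: "'a sentence"
    interpret F: Vector_Spaces.linear scale "(*)" "F K :: ('a, 'k) nsym \<Rightarrow> 'k"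
      by (rule linear_F)
    have single: "Poly_Mapping.single L c = scale c (H L)" for L :: "'a sentence" and c :: 'k
      by (simp add: H_def scale_single)
    \<comment> \<open>On basis elements \<open>F K\<close> is the indicator of refining
      \<open>K\<close>, so it restricts the sum to the common refinements of \<open>J\<close> and
      \<open>K\<close>.\<close>
    have "?f (H J) = (\<Sum>L | refines L J. (-1) ^ length (words_of L) * (if refines L K then 1 else 0))"
      by (simp add: antipode_reversal_H F.sum single F.scale F_H)
    also have "\<dots> = (\<Sum>L | refines L K \<and> refines L J. (-1) ^ length (words_of L))"
      by (rule sum.mono_neutral_cong_right) (auto simp: finite_refinements)
    also have "\<dots> = ?g (H J)"
      by (simp add: sum_common_refinements F_H)
    finally show "?f (Poly_Mapping.single J 1) = ?g (Poly_Mapping.single J 1)"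
      unfolding H_def .
  qed
  then show ?thesis
    by (rule fun_cong)
qed

theorem corollary5p8:
  fixes I :: "'a::finite sentence"
  shows "(antipode \<circ> reversal_map) (R I :: ('a, 'k::field_char_0) nsym)
    = scale ((-1) ^ letters I) (R (complement I))"
proof (rule F_separates)
  fix K :: "'a sentence"
  interpret F: Vector_Spaces.linear scale "(*)" "F K :: ('a, 'k) nsym \<Rightarrow> 'k"
    by (rule linear_F)
  \<comment> \<open>By adjointness the left side is non-zero only for
    \<open>complement K = I\<close>, the right side only for \<open>K = complement I\<close>. The
    complement is an involution that preserves the number of letters, so the conditions and the
    signs agree.\<close>
  have "complement K = I \<longleftrightarrow> K = complement I"
    by auto
  then show "F K ((antipode \<circ> reversal_map) (R I :: ('a, 'k) nsym)) =
      F K (scale ((-1) ^ letters I) (R (complement I)))"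
    by (auto simp: F_antipode_reversal F_R F.scale)
qed

end
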